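(* For every integer $k > 1$, $\mathrm{DTIME}[\log^k n] \subsetneq \mathrm{DTIME}[\log^{k+1} n]$.
   Context: Throughout, $\log n$ denotes $\log_2 n$ and $\log^k n$ denotes $(\log n)^k$. A random-access Turing machine is a multi-tape Turing machine with (1) a read-only random-access input of length $n+1$ whose first $n$ cells contain the input binary string (each cell $0$ or $1$) and whose $(n+1)$-st cell contains an endmark $\triangleleft$, (2) a fixed number of read-write working tapes, and (3) a read-write input address-tape of length $\lceil \log n\rceil$ containing bits; at each step the binary number on the address-tape determines the input cell that is read, and if this number exceeds $n$ the endmark cell is read. For a function $f$, $\mathrm{DTIME}[f(n)]$ is the class of languages of binary strings accepted by a deterministic random-access Turing machine that makes at most $O(f(n))$ steps on inputs of length $n$. *)

theory Defs
  imports Complex_Main "HOL-Library.Landau_Symbols"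
begin

datatype input_symbol = Bit bool | Endmark

datatype head_move = MoveLeft | Stay | MoveRight

(*
  States and working-tape symbols are coded as initial segments of nat, so that machines
  with arbitrary finite state sets and alphabets all have one type; symbol 0 is the blank.
  delta maps (state, input symbol read, address bit read, working symbols read) to
  (new state, bit written to the address-tape, move of the address-tape head,
  symbol written and head move for each working tape).
*)
record ratm =
  num_states :: nat
  num_symbols :: nat
  num_tapes :: nat
  start_state :: nat
  accept_state :: nat
  reject_state :: nat
  delta :: "nat \<Rightarrow> input_symbol \<Rightarrow> bool \<Rightarrow> nat list
    \<Rightarrow> nat \<times> bool \<times> head_move \<times> (nat \<times> head_move) list"

definition wf_ratm :: "ratm \<Rightarrow> bool" where
  "wf_ratm M \<longleftrightarrow>
     start_state M < num_states M \<and>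
     accept_state M < num_states M \<and>
     reject_state M < num_states M \<and>
     accept_state M \<noteq> reject_state M \<and>
     0 < num_symbols M \<and>
     (\<forall>q s b ws q' b' d acts.
        q < num_states M \<longrightarrow> length ws = num_tapes M \<longrightarrow> set ws \<subseteq> {..<num_symbols M} \<longrightarrow>
        delta M q s b ws = (q', b', d, acts) \<longrightarrow>
        q' < num_states M \<and> length acts = num_tapes M \<and> fst ` set acts \<subseteq> {..<num_symbols M})"

record config =
  cstate :: nat
  addr_head :: nat
  addr_tape :: "bool list"
  work :: "(nat \<times> (nat \<Rightarrow> nat)) list"  \<comment> \<open>head position and contents of each tape\<close>

(* Since log 2 0 = 0 here, the address-tape has no cells for n = 0 and for n = 1. *)
definition addr_length :: "nat \<Rightarrow> nat" where
  "addr_length n = nat \<lceil>log 2 (real n)\<rceil>"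

(* The leftmost cell holds the most significant bit; the empty tape denotes 0. *)
definition addr_value :: "bool list \<Rightarrow> nat" where
  "addr_value t = horner_sum of_bool 2 (rev t)"

(* Input cells are numbered from 0, so that the endmark is in cell number n. *)
definition read_input :: "bool list \<Rightarrow> nat \<Rightarrow> input_symbol" where
  "read_input x a = (if a < length x then Bit (x ! a) else Endmark)"

(* The second case concerns only an address-tape without cells; there writing has no effect. *)
definition read_addr :: "bool list \<Rightarrow> nat \<Rightarrow> bool" where
  "read_addr t p = (if p < length t then t ! p else False)"

(* Tapes have a leftmost cell, on which a move to the left has no effect. *)
fun move_head :: "head_move \<Rightarrow> nat \<Rightarrow> nat" where
  "move_head MoveLeft p = p - 1"
| "move_head Stay p = p"
| "move_head MoveRight p = p + 1"

definition init_config :: "ratm \<Rightarrow> bool list \<Rightarrow> config" where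
  "init_config M x =
     \<lparr>cstate = start_state M,
      addr_head = 0,
      addr_tape = replicate (addr_length (length x)) False,
      work = replicate (num_tapes M) (0, \<lambda>_. 0)\<rparr>"

definition halted :: "ratm \<Rightarrow> config \<Rightarrow> bool" where
  "halted M c \<longleftrightarrow> cstate c \<in> {accept_state M, reject_state M}"

(* The minimum keeps the address-tape head on the tape at its right end. *)
definition step :: "ratm \<Rightarrow> bool list \<Rightarrow> config \<Rightarrow> config" where
  "step M x c =
     (if halted M c then c
      else
        let (q, b, d, acts) =
              delta M (cstate c)
                (read_input x (addr_value (addr_tape c)))
                (read_addr (addr_tape c) (addr_head c))
                (map (\<lambda>(p, t). t p) (work c))
        in
          \<lparr>cstate = q,
           addr_head = min (move_head d (addr_head c)) (length (addr_tape c) - 1),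
           addr_tape = (addr_tape c)[addr_head c := b],
           work = map2 (\<lambda>(p, t) (s, e). (move_head e p, t(p := s))) (work c) acts\<rparr>)"

definition run :: "ratm \<Rightarrow> bool list \<Rightarrow> nat \<Rightarrow> config" where
  "run M x t = (step M x ^^ t) (init_config M x)"

(* Halted configurations are fixed by step, so being halted after T steps means that
   the machine makes at most T steps. *)
definition decides_in_time :: "ratm \<Rightarrow> bool list set \<Rightarrow> (nat \<Rightarrow> nat) \<Rightarrow> bool" where
  "decides_in_time M L T \<longleftrightarrow>
     (\<forall>x. halted M (run M x (T (length x))) \<and>
          (x \<in> L \<longleftrightarrow> cstate (run M x (T (length x))) = accept_state M))"

definition DTIME :: "(nat \<Rightarrow> real) \<Rightarrow> bool list set set" where
  "DTIME f = {L. \<exists>M T. wf_ratm M \<and> (\<lambda>n. real (T n)) \<in> O(f) \<and> decides_in_time M L T}"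

end

theory Submission
  imports Defs
begin

text \<open>
  No diagonalisation is needed: a machine making \<open>t\<close> steps reads at most \<open>t\<close> input cells. Write
  \<open>m\<close> for the length of the address-tape. A machine without working tapes can set the first address
  bit and then enumerate, by depth-first search with one head and a counter in its finite control,
  all address-tapes with at most \<open>k + 1\<close> further ones; it rejects as soon as it reads a 1 in the
  input, and accepts otherwise. This takes \<open>O(m ^ (k + 1))\<close> steps. Conversely, any machine deciding
  the same language must, on the input \<open>0 ^ (2 ^ m)\<close>, read all these cells, as flipping one that is
  not read would go unnoticed. There are at least \<open>(m - 1) choose (k + 1)\<close> of them, which is not
  \<open>O(m ^ k)\<close>.
\<close>

section \<open>Unread input cells\<close>

definition queries :: "ratm \<Rightarrow> bool list \<Rightarrow> nat \<Rightarrow> nat set" where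
  "queries M x t = (\<lambda>i. addr_value (addr_tape (run M x i))) ` {..<t}"

lemma run_0 [simp]: "run M x 0 = init_config M x"
  by (simp add: run_def)

lemma run_Suc: "run M x (Suc t) = step M x (run M x t)"
  by (simp add: run_def)

lemma card_queries: "card (queries M x t) \<le> t"
  unfolding queries_def by (rule order.trans[OF card_image_le]) auto

text \<open>A step sees the input only through the addressed cell, and an update keeps the input
  length and with it the initial address-tape. So both runs agree as long as no address equals
  \<open>p\<close>.\<close>

lemma run_update_unread:
  assumes "p \<notin> queries M x t"
  shows "run M (x[p := b]) t = run M x t"
  using assms
proof (induction t)
  case 0
  then show ?case by (simp add: init_config_def)
next
  case (Suc t)
  have eq: "run M (x[p := b]) t = run M x t"
    using Suc by (simp add: queries_def lessThan_Suc)
  have "addr_value (addr_tape (run M x t)) \<noteq> p"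
    using Suc.prems by (auto simp: queries_def)
  then have "read_input (x[p := b]) (addr_value (addr_tape (run M x t))) =
             read_input x (addr_value (addr_tape (run M x t)))"
    by (simp add: read_input_def)
  then show ?case
    unfolding run_Suc eq by (simp add: step_def)
qed

text \<open>By \<open>run_update_unread\<close>, every \<open>p\<close> in \<open>P\<close> must be
  queried, and each step queries a single address.\<close>

lemma sensitive_le_time:
  assumes dec: "decides_in_time M L T" and x: "x \<in> L"
    and P: "\<And>p. p \<in> P \<Longrightarrow> x[p := b] \<notin> L"
  shows "card P \<le> T (length x)"
proof -
  have "P \<subseteq> queries M x (T (length x))"
  proof
    fix p assume "p \<in> P"
    show "p \<in> queries M x (T (length x))"
    proof (rule ccontr)
      assume "p \<notin> queries M x (T (length x))"
      then have "run M (x[p := b]) (T (length (x[p := b]))) = run M x (T (length x))"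
        by (simp add: run_update_unread)
      then have "x[p := b] \<in> L"
        using dec x unfolding decides_in_time_def by metis
      with P[OF \<open>p \<in> P\<close>] show False ..
    qed
  qed
  then have "card P \<le> card (queries M x (T (length x)))"
    by (intro card_mono) (simp_all add: queries_def)
  then show ?thesis
    using card_queries order.trans by blast
qed

section \<open>The probing machine\<close>

text \<open>
  States 0 and 1 accept and reject, states 2 and 3 set the first address bit. In state \<open>fwd j\<close>
  the search has set \<open>j\<close> bits after the first one, all to the left of the head, and tries to set
  one more; in state \<open>bwd j\<close> it looks for the last bit that was set.
\<close>

abbreviation fwd :: "nat \<Rightarrow> nat" where
  "fwd j \<equiv> 4 + 2 * j"

abbreviation bwd :: "nat \<Rightarrow> nat" where
  "bwd j \<equiv> 5 + 2 * j"

text \<open>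
  In state \<open>fwd j\<close> the cells from the head on contain 0, unless the head was stopped by the right end
  of the tape and is still on the 1 just written. Likewise, state 3 sees a 0 only if the tape has no cells.
\<close>

definition probe_delta ::
  "nat \<Rightarrow> nat \<Rightarrow> input_symbol \<Rightarrow> bool \<Rightarrow> nat list \<Rightarrow> nat \<times> bool \<times> head_move \<times> (nat \<times> head_move) list"
where
  "probe_delta K q s b ws =
     (let j = (q - 4) div 2 in
      if s = Bit True then (1, b, Stay, [])
      else if q = 2 then (3, True, Stay, [])
      else if q = 3 then (if b then (fwd 0, True, MoveRight, []) else (0, b, Stay, []))
      else if even q then
        (if b then (if j = 0 then (0, b, Stay, []) else (bwd (j - 1), False, MoveLeft, []))
         else if j < K then (fwd (j + 1), True, MoveRight, [])
         else (bwd j, False, MoveLeft, []))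
      else
        (if b then (if j = 0 then (0, b, Stay, []) else (fwd (j - 1), False, MoveRight, []))
         else (bwd j, False, MoveLeft, [])))"

text \<open>The largest state is \<open>bwd K = 5 + 2 * K\<close>. The one symbol is the blank,
  since \<open>wf_ratm\<close> asks for a nonempty alphabet.\<close>

definition probe :: "nat \<Rightarrow> ratm" where
  "probe K = \<lparr>num_states = 6 + 2 * K, num_symbols = 1, num_tapes = 0,
     start_state = 2, accept_state = 0, reject_state = 1, delta = probe_delta K\<rparr>"

lemma probe_simps [simp]:
  "num_states (probe K) = 6 + 2 * K" "num_symbols (probe K) = 1" "num_tapes (probe K) = 0"
  "start_state (probe K) = 2" "accept_state (probe K) = 0" "reject_state (probe K) = 1"
  "delta (probe K) = probe_delta K"
  by (simp_all add: probe_def)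

lemma wf_probe: "wf_ratm (probe K)"
proof -
  have "q' < 6 + 2 * K \<and> acts = []"
    if "q < 6 + 2 * K" "probe_delta K q s b ws = (q', b', d, acts)" for q s b ws q' b' d acts
  proof -
    define j where "j = (q - 4) div 2"
    have "j \<le> K" using that(1) by (simp add: j_def)
    then show ?thesis
      using that(2) unfolding probe_delta_def Let_def j_def[symmetric] by (auto split: if_splits)
  qed
  then show ?thesis
    unfolding wf_ratm_def by fastforce
qed

section \<open>Halting, and comparison with the run on the empty input\<close>

lemma step_halted: "halted M c \<Longrightarrow> step M x c = c"
  by (simp add: step_def)

lemma halted_funpow:
  assumes "halted M c"
  shows "(step M x ^^ t) c = c"
  by (induction t) (use assms in \<open>simp_all add: step_halted\<close>)

lemma halted_funpow_mono:
  assumes "halted M ((step M x ^^ s) c)" "s \<le> t"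
  shows "(step M x ^^ t) c = (step M x ^^ s) c"
proof -
  have "(step M x ^^ t) c = (step M x ^^ (t - s)) ((step M x ^^ s) c)"
    using assms(2) by (simp flip: funpow_add[THEN fun_cong, unfolded o_apply])
  then show ?thesis
    using halted_funpow[OF assms(1)] by simp
qed

text \<open>On the empty input only the endmark is read, so \<open>step (probe K) []\<close> is the search without the
  test for ones in the input.\<close>

lemma probe_step_cases:
  "step (probe K) x c = step (probe K) [] c \<or> cstate (step (probe K) x c) = 1"
  by (auto simp: step_def Let_def probe_delta_def read_input_def split: if_splits)

lemma probe_funpow_cases:
  "(step (probe K) x ^^ t) c = (step (probe K) [] ^^ t) c \<or> cstate ((step (probe K) x ^^ t) c) = 1"
proof (induction t)
  case (Suc t)
  then show ?case
  proof
    assume "cstate ((step (probe K) x ^^ t) c) = 1"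
    then show ?thesis by (simp add: step_halted halted_def)
  next
    assume "(step (probe K) x ^^ t) c = (step (probe K) [] ^^ t) c"
    then show ?thesis using probe_step_cases[of K x] by simp
  qed
qed simp

lemma probe_reads_True:
  assumes "\<not> halted (probe K) c" "read_input x (addr_value (addr_tape c)) = Bit True"
  shows "cstate (step (probe K) x c) = 1"
  using assms by (simp add: step_def probe_delta_def)

text \<open>Up to time \<open>i\<close> the run on \<open>x\<close> either follows the run on the
  empty input, and then meets the 1 itself, or has rejected already. So it suffices to know which
  tapes the input-independent search visits.\<close>

lemma probe_funpow_reads_True:
  assumes "\<not> halted (probe K) ((step (probe K) [] ^^ i) c)" "i < t"
    and "read_input x (addr_value (addr_tape ((step (probe K) [] ^^ i) c))) = Bit True"
  shows "cstate ((step (probe K) x ^^ t) c) = 1"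
proof -
  have 1: "cstate ((step (probe K) x ^^ Suc i) c) = 1"
    using probe_funpow_cases[of i K x c]
  proof
    assume "(step (probe K) x ^^ i) c = (step (probe K) [] ^^ i) c"
    then show ?thesis using probe_reads_True[OF assms(1,3)] by simp
  next
    assume "cstate ((step (probe K) x ^^ i) c) = 1"
    then show ?thesis by (simp add: step_halted halted_def)
  qed
  then have "halted (probe K) ((step (probe K) x ^^ Suc i) c)"
    by (simp add: halted_def)
  from halted_funpow_mono[OF this, of t] show ?thesis
    using 1 assms(2) by simp
qed

lemma probe_funpow_reads_no_True:
  assumes "\<And>a. read_input x a \<noteq> Bit True"
  shows "(step (probe K) x ^^ t) c = (step (probe K) [] ^^ t) c"
proof -
  have "step (probe K) x c = step (probe K) [] c" for c
    using assms by (auto simp: step_def Let_def probe_delta_def read_input_def)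
  then show ?thesis by (induction t) simp_all
qed

section \<open>The search\<close>

definition conf :: "nat \<Rightarrow> nat \<Rightarrow> bool list \<Rightarrow> config" where
  "conf q p t = \<lparr>cstate = q, addr_head = p, addr_tape = t, work = []\<rparr>"

lemma conf_simps [simp]:
  "cstate (conf q p t) = q" "addr_tape (conf q p t) = t"
  by (simp_all add: conf_def)

lemma step_conf:
  assumes "1 < q" "probe_delta K q Endmark (read_addr t p) [] = (q', b, d, [])"
  shows "step (probe K) [] (conf q p t) = conf q' (min (move_head d p) (length t - 1)) (t[p := b])"
  using assms by (simp add: step_def conf_def halted_def read_input_def)

lemma step_fwd_0:
  assumes "p < length t" "\<not> t ! p" "j < K"
  shows "step (probe K) [] (conf (fwd j) p t) =
    conf (fwd (Suc j)) (min (Suc p) (length t - 1)) (t[p := True])"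
  using assms by (subst step_conf) (auto simp: probe_delta_def read_addr_def)

lemma step_fwd_last:
  assumes "p < length t" "\<not> t ! p"
  shows "step (probe K) [] (conf (fwd K) p t) = conf (bwd K) (p - 1) t"
  using assms list_update_id[of t p]
  by (subst step_conf) (auto simp: probe_delta_def read_addr_def)

lemma step_fwd_1:
  assumes "p < length t" "t ! p"
  shows "step (probe K) [] (conf (fwd (Suc j)) p t) = conf (bwd j) (p - 1) (t[p := False])"
  using assms by (subst step_conf) (auto simp: probe_delta_def read_addr_def)

lemma step_bwd_0:
  assumes "p < length t" "\<not> t ! p"
  shows "step (probe K) [] (conf (bwd j) p t) = conf (bwd j) (p - 1) t"
  using assms list_update_id[of t p]
  by (subst step_conf) (auto simp: probe_delta_def read_addr_def)

lemma step_bwd_1: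
  assumes "Suc p < length t" "t ! p"
  shows "step (probe K) [] (conf (bwd (Suc j)) p t) = conf (fwd j) (Suc p) (t[p := False])"
  using assms by (subst step_conf) (auto simp: probe_delta_def read_addr_def)

text \<open>Time \<open>t\<close> is left out because it starts the next path. The inclusion allows
  tapes visited on the way to be dropped from \<open>A\<close>.\<close>

definition search_path :: "nat \<Rightarrow> nat \<Rightarrow> config \<Rightarrow> config \<Rightarrow> bool list set \<Rightarrow> bool" where
  "search_path K t c c' A \<longleftrightarrow> (step (probe K) [] ^^ t) c = c' \<and>
     A \<subseteq> (\<lambda>i. addr_tape ((step (probe K) [] ^^ i) c)) ` {..<t}"

lemma search_path_step:
  assumes "step (probe K) [] c = c'"
  shows "search_path K 1 c c' {addr_tape c}"
  using assms by (simp add: search_path_def)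

lemma search_path_trans:
  assumes "search_path K s c c' A" "search_path K t c' c'' B"
  shows "search_path K (s + t) c c'' (A \<union> B)"
proof -
  have shift: "(step (probe K) [] ^^ (s + i)) c = (step (probe K) [] ^^ i) c'" for i
    using assms(1) by (simp add: search_path_def add.commute[of s] funpow_add)
  have "A \<subseteq> (\<lambda>i. addr_tape ((step (probe K) [] ^^ i) c)) ` {..<s + t}"
    using assms(1) by (fastforce simp: search_path_def)
  moreover have "v \<in> (\<lambda>i. addr_tape ((step (probe K) [] ^^ i) c)) ` {..<s + t}" if "v \<in> B" for v
  proof -
    from that obtain i where "i < t" "v = addr_tape ((step (probe K) [] ^^ i) c')"
      using assms(2) by (auto simp: search_path_def)
    then show ?thesis
      by (intro image_eqI[of _ _ "s + i"]) (simp_all add: shift)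
  qed
  ultimately show ?thesis
    using assms(2) shift[of t] by (auto simp: search_path_def)
qed

lemma search_path_subset:
  "search_path K t c c' A \<Longrightarrow> B \<subseteq> A \<Longrightarrow> search_path K t c c' B"
  by (auto simp: search_path_def)

definition sparse :: "nat \<Rightarrow> nat \<Rightarrow> bool list set" where
  "sparse l r = {v. length v = l \<and> count_list v True \<le> r}"

lemma sparse_0: "sparse l 0 = {replicate l False}"
proof -
  have "v = replicate l False" if "length v = l" "True \<notin> set v" for v
    using that by (metis (full_types) replicate_eqI)
  then show ?thesis by (auto simp: sparse_def count_list_0_iff)
qed

text \<open>The two parts are the two branches of the search at a cell: first it is set, using up
  one of the \<open>Suc r\<close> ones, then it is cleared.\<close>

lemma sparse_Suc:
  "sparse (Suc l) (Suc r) = Cons True ` sparse l r \<union> Cons False ` sparse l (Suc r)"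
proof (intro equalityI subsetI)
  fix v assume "v \<in> sparse (Suc l) (Suc r)"
  then obtain b w where "v = b # w" "length w = l" "count_list (b # w) True \<le> Suc r"
    by (cases v) (auto simp: sparse_def)
  then show "v \<in> Cons True ` sparse l r \<union> Cons False ` sparse l (Suc r)"
    by (cases b) (auto simp: sparse_def)
qed (auto simp: sparse_def)

text \<open>Induction on the cells to the right of the head: set the cell, search the rest with one
  bit fewer, return to the 1, clear it, search the rest again, and step back over the 0. The two
  recursive searches cost three extra steps in all; the summand \<open>3\<close> makes the bound
  absorb them. As \<open>u\<close> is nonempty, the head really returns to the last cell of
  \<open>u\<close>.\<close>

lemma search:
  assumes "j \<le> K" "u \<noteq> []"
  shows "\<exists>t. t + 3 \<le> 4 * (l + 2) ^ (K - j) \<and>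
     search_path K t (conf (fwd j) (length u) (u @ replicate (Suc l) False))
       (conf (bwd j) (length u - 1) (u @ replicate (Suc l) False)) ((@) u ` sparse (Suc l) (K - j))"
  using assms
proof (induction l arbitrary: j u)
  case (0 j u)
  show ?case
  proof (cases "j = K")
    case True
    have "search_path K 1 (conf (fwd K) (length u) (u @ [False]))
        (conf (bwd K) (length u - 1) (u @ [False])) {u @ [False]}"
      using search_path_step[OF step_fwd_last[of "length u" "u @ [False]" K]] by simp
    then show ?thesis
      using True by (intro exI[of _ 1]) (simp add: sparse_0)
  next
    case False
    with 0 have j: "j < K" by simp
    then obtain r where r: "K - j = Suc r"
      by (metis Suc_diff_Suc)
    have "search_path K 1 (conf (fwd j) (length u) (u @ [False]))
        (conf (fwd (Suc j)) (length u) (u @ [True])) {u @ [False]}"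
      using search_path_step[OF step_fwd_0[of "length u" "u @ [False]" j K]] j by simp
    \<comment> \<open>Only one cell is left, so \<open>min\<close> keeps the head on the 1 just
      written; reading it, \<open>fwd (Suc j)\<close> notices the end of the tape and turns
      back.\<close>
    moreover have "search_path K 1 (conf (fwd (Suc j)) (length u) (u @ [True]))
        (conf (bwd j) (length u - 1) (u @ [False])) {u @ [True]}"
      using search_path_step[OF step_fwd_1[of "length u" "u @ [True]" K j]] by simp
    ultimately have "search_path K (1 + 1) (conf (fwd j) (length u) (u @ [False]))
        (conf (bwd j) (length u - 1) (u @ [False])) ({u @ [False]} \<union> {u @ [True]})"
      by (rule search_path_trans)
    moreover have "sparse (Suc 0) (Suc r) = {[True], [False]}"
      unfolding sparse_Suc by (auto simp: sparse_def)
    moreover have "(1 + 1) + 3 \<le> 4 * (2::nat) ^ (K - j)"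
      unfolding r power_Suc using zero_less_power[of "2::nat" r, OF zero_less_numeral] by linarith
    ultimately show ?thesis
      unfolding r by (intro exI[of _ "1 + 1"]) (simp add: insert_commute flip: numeral_2_eq_2)
  qed
next
  case (Suc l j u)
  let ?z = "replicate (Suc l) False"
  let ?c = "conf (fwd j) (length u) (u @ False # ?z)"
  let ?c' = "conf (bwd j) (length u - 1) (u @ False # ?z)"
  have z: "replicate (Suc (Suc l)) False = False # ?z" by simp
  show ?case
  proof (cases "j = K")
    case True
    have "search_path K 1 ?c ?c' {u @ False # ?z}"
      using search_path_step[OF step_fwd_last[of "length u" "u @ False # ?z" K]] True by simp
    then show ?thesis
      using True by (intro exI[of _ 1]) (simp add: sparse_0)
  next
    case False
    with Suc.prems have j: "j < K" by simp
    then obtain r where r: "K - j = Suc r" "K - Suc j = r"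
      by (metis Suc_diff_Suc)
    have ne: "u @ [b] \<noteq> []" for b by simp
    have 1: "search_path K 1 ?c (conf (fwd (Suc j)) (length (u @ [True])) ((u @ [True]) @ ?z))
        {u @ False # ?z}"
      using search_path_step[OF step_fwd_0[of "length u" "u @ False # ?z" j K]] j by simp
    obtain t1 where t1: "t1 + 3 \<le> 4 * (l + 2) ^ r"
      and 2: "search_path K t1 (conf (fwd (Suc j)) (length (u @ [True])) ((u @ [True]) @ ?z))
        (conf (bwd (Suc j)) (length (u @ [True]) - 1) ((u @ [True]) @ ?z))
        ((@) (u @ [True]) ` sparse (Suc l) r)"
      using Suc.IH[OF Suc_leI[OF j] ne[of True]] unfolding r by blast
    have 3: "search_path K 1 (conf (bwd (Suc j)) (length (u @ [True]) - 1) ((u @ [True]) @ ?z))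
        (conf (fwd j) (length (u @ [False])) ((u @ [False]) @ ?z)) {(u @ [True]) @ ?z}"
      using search_path_step[OF step_bwd_1[of "length u" "u @ True # ?z" K j]] by simp
    obtain t2 where t2: "t2 + 3 \<le> 4 * (l + 2) ^ Suc r"
      and 4: "search_path K t2 (conf (fwd j) (length (u @ [False])) ((u @ [False]) @ ?z))
        (conf (bwd j) (length (u @ [False]) - 1) ((u @ [False]) @ ?z))
        ((@) (u @ [False]) ` sparse (Suc l) (Suc r))"
      using Suc.IH[OF less_imp_le[OF j] ne[of False]] unfolding r by blast
    have 5: "search_path K 1 (conf (bwd j) (length (u @ [False]) - 1) ((u @ [False]) @ ?z)) ?c'
        {(u @ [False]) @ ?z}"
      using search_path_step[OF step_bwd_0[of "length u" "u @ False # ?z" K j]] by simp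
    \<comment> \<open>The bounds of both recursive searches add up to one with the base raised by 1,
      as for Pascal's identity.\<close>
    have "(l + 2) ^ r + (l + 2) ^ Suc r = (l + 2) ^ r * (Suc l + 2)"
      by simp
    also have "\<dots> \<le> (Suc l + 2) ^ r * (Suc l + 2)"
      by (intro mult_right_mono power_mono) auto
    also have "\<dots> = (Suc l + 2) ^ Suc r"
      by (simp only: power_Suc2)
    finally have "1 + (t1 + (1 + (t2 + 1))) + 3 \<le> 4 * (Suc l + 2) ^ Suc r"
      using t1 t2 by linarith
    moreover have "(@) u ` sparse (Suc (Suc l)) (Suc r) =
        (@) (u @ [True]) ` sparse (Suc l) r \<union> (@) (u @ [False]) ` sparse (Suc l) (Suc r)"
      unfolding sparse_Suc[of "Suc l"] by (simp add: image_Un image_image)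
    then have "search_path K (1 + (t1 + (1 + (t2 + 1)))) ?c ?c'
        ((@) u ` sparse (Suc (Suc l)) (Suc r))"
      using search_path_trans[OF 1 search_path_trans[OF 2 search_path_trans[OF 3 search_path_trans[OF 4 5]]]]
      by (elim search_path_subset) auto
    ultimately show ?thesis
      unfolding r z by blast
  qed
qed

lemma init_config_probe:
  "init_config (probe K) x = conf 2 0 (replicate (addr_length (length x)) False)"
  by (simp add: init_config_def conf_def)

lemma step_start:
  "step (probe K) [] (conf 2 0 (replicate m False)) = conf 3 0 ((replicate m False)[0 := True])"
  by (subst step_conf) (auto simp: probe_delta_def)

text \<open>The 1 in the first cell is a sentinel: it plays the part of \<open>u\<close> in
  \<open>search\<close>, and \<open>bwd 0\<close> returns to it once everything has been
  enumerated.\<close>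

lemma full_search:
  assumes "m > 1"
  shows "\<exists>t. t + 1 \<le> 4 * m ^ K \<and>
     search_path K t (conf 2 0 (replicate m False)) (conf (bwd 0) 0 (True # replicate (m - 1) False))
       (Cons True ` sparse (m - 1) K)"
proof -
  from assms obtain l where m: "m = Suc (Suc l)"
    by (metis One_nat_def less_imp_Suc_add plus_1_eq_Suc add_Suc)
  let ?z = "replicate (Suc l) False"
  have 1: "search_path K 1 (conf 2 0 (replicate m False)) (conf 3 0 ([True] @ ?z)) {replicate m False}"
    using search_path_step[OF step_start[of K m]] by (simp add: m)
  have "step (probe K) [] (conf 3 0 ([True] @ ?z)) = conf (fwd 0) (length [True]) ([True] @ ?z)"
    by (subst step_conf) (auto simp: probe_delta_def read_addr_def)
  note 2 = search_path_step[OF this]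
  obtain t where t: "t + 3 \<le> 4 * (l + 2) ^ K"
    and 3: "search_path K t (conf (fwd 0) (length [True]) ([True] @ ?z))
      (conf (bwd 0) (length [True] - 1) ([True] @ ?z)) ((@) [True] ` sparse (Suc l) K)"
    using search[of 0 K "[True]" l] by auto
  have "(@) [True] = Cons True"
    by auto
  then have "search_path K (1 + (1 + t)) (conf 2 0 (replicate m False))
      (conf (bwd 0) 0 (True # ?z)) (Cons True ` sparse (Suc l) K)"
    using search_path_subset[OF search_path_trans[OF 1 search_path_trans[OF 2 3]]
        subset_trans[OF Un_upper2 Un_upper2]] by simp
  then show ?thesis
    \<comment> \<open>The two initial steps use up 2 of the surplus 3 in \<open>search\<close>; the
      remaining 1 pays for the accepting step.\<close>
    using t unfolding m by (intro exI[of _ "1 + (1 + t)"]) simp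
qed

text \<open>The additive 4 covers tapes with no cell or one cell, where acceptance comes after two
  or three steps; longer tapes are handled by \<open>full_search\<close>.\<close>

lemma search_halts: "cstate ((step (probe K) [] ^^ (4 * m ^ K + 4)) (conf 2 0 (replicate m False))) = 0"
proof -
  let ?S = "step (probe K) []" and ?c = "conf 2 0 (replicate m False)"
  have *: ?thesis if "cstate (?S ((?S ^^ s) ?c)) = 0" "s < 4 * m ^ K + 4" for s
    using that halted_funpow_mono[of "probe K" "Suc s" "[]" ?c "4 * m ^ K + 4"]
    by (simp add: halted_def)
  consider "m = 0" | "m = 1" | "m > 1" by linarith
  then show ?thesis
  proof cases
    case 1
    have "cstate (?S (conf 3 0 [])) = 0"
      by (subst step_conf) (auto simp: probe_delta_def read_addr_def)
    then show ?thesis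
      using *[of 1] step_start[of K m] 1 by simp
  next
    case 2
    have "?S (conf 3 0 [True]) = conf (fwd 0) 0 [True]"
      by (subst step_conf) (auto simp: probe_delta_def read_addr_def)
    moreover have "cstate (?S (conf (fwd 0) 0 [True])) = 0"
      by (subst step_conf) (auto simp: probe_delta_def read_addr_def)
    ultimately show ?thesis
      using *[of 2] step_start[of K m] 2 by (simp add: numeral_2_eq_2)
  next
    case 3
    then obtain t where t: "t + 1 \<le> 4 * m ^ K"
      "(?S ^^ t) ?c = conf (bwd 0) 0 (True # replicate (m - 1) False)"
      using full_search unfolding search_path_def by blast
    have "cstate (?S (conf (bwd 0) 0 (True # replicate (m - 1) False))) = 0"
      by (subst step_conf) (auto simp: probe_delta_def read_addr_def)
    then show ?thesis
      using *[of t] t by simp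
  qed
qed

lemma search_visits:
  assumes "m > 1" "v \<in> sparse (m - 1) K"
  shows "\<exists>i<4 * m ^ K + 4. \<not> halted (probe K) ((step (probe K) [] ^^ i) (conf 2 0 (replicate m False))) \<and>
    addr_tape ((step (probe K) [] ^^ i) (conf 2 0 (replicate m False))) = True # v"
proof -
  let ?S = "step (probe K) []" and ?c = "conf 2 0 (replicate m False)"
  from full_search[OF assms(1)] assms(2) obtain t i where t: "t + 1 \<le> 4 * m ^ K"
    "(?S ^^ t) ?c = conf (bwd 0) 0 (True # replicate (m - 1) False)"
    and i: "i < t" "addr_tape ((?S ^^ i) ?c) = True # v"
    unfolding search_path_def by (smt (verit) image_iff image_subset_iff lessThan_iff)
  \<comment> \<open>Halting is permanent and the state at time \<open>t\<close> is still
    \<open>bwd 0\<close>, so no earlier configuration is halted and its addressed cell is indeed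
    tested.\<close>
  have "\<not> halted (probe K) ((?S ^^ t) ?c)"
    unfolding t(2) by (simp add: halted_def)
  then have "\<not> halted (probe K) ((?S ^^ i) ?c)"
    using halted_funpow_mono[of "probe K" i "[]" ?c t] i(1) by auto
  then show ?thesis
    using i t(1) by (intro exI[of _ i]) auto
qed

section \<open>The separating language\<close>

text \<open>Taking whatever \<open>probe K\<close> accepts reduces the upper bound to halting.
  Concerning membership, only the all-zero input and its one-bit changes will be examined.\<close>

definition probe_language :: "nat \<Rightarrow> bool list set" where
  "probe_language K =
     {x. cstate (run (probe K) x (4 * addr_length (length x) ^ K + 4)) = accept_state (probe K)}"

lemma probe_decides: "decides_in_time (probe K) (probe_language K) (\<lambda>n. 4 * addr_length n ^ K + 4)"
proof -
  have "halted (probe K) (run (probe K) x (4 * addr_length (length x) ^ K + 4))" for x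
    using probe_funpow_cases[of "4 * addr_length (length x) ^ K + 4" K x "init_config (probe K) x"]
      search_halts[of "addr_length (length x)" K]
    by (auto simp: run_def init_config_probe halted_def simp del: funpow.simps)
  then show ?thesis
    by (auto simp: decides_in_time_def probe_language_def)
qed

section \<open>Addresses as binary numbers, and counting address-tapes by weight\<close>

lemma addr_length_power [simp]: "addr_length (2 ^ m) = m"
  by (simp add: addr_length_def)

lemma addr_value_append [simp]: "addr_value (xs @ [b]) = of_bool b + 2 * addr_value xs"
  by (simp add: addr_value_def)

lemma addr_value_Nil [simp]: "addr_value [] = 0"
  by (simp add: addr_value_def)

lemma addr_value_less: "addr_value t < 2 ^ length t"
  by (induction t rule: rev_induct) auto

lemma addr_value_inject:
  assumes "length s = length t" "addr_value s = addr_value t"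
  shows "s = t"
  using assms
proof (induction t arbitrary: s rule: rev_induct)
  case (snoc b t)
  then obtain s' a where s: "s = s' @ [a]"
    by (cases s rule: rev_cases) auto
  have "a = b \<and> addr_value s' = addr_value t"
    using snoc.prems unfolding s by (cases a; cases b; simp; presburger)
  then show ?case
    using snoc by (auto simp: s)
qed simp

text \<open>Pascal's identity, splitting by the first bit. Finiteness is carried along for the
  cardinality of the disjoint union.\<close>

lemma card_weight_lists:
  "finite {v. length v = l \<and> count_list v True = r} \<and>
   card {v. length v = l \<and> count_list v True = r} = l choose r"
proof (induction l arbitrary: r)
  case 0
  have "{v :: bool list. length v = 0 \<and> count_list v True = r} = (if r = 0 then {[]} else {})"
    by auto
  then show ?case by simp
next
  case (Suc l)
  let ?A = "\<lambda>l r. {v. length v = l \<and> count_list v True = r}"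
  show ?case
  proof (cases r)
    case 0
    have "?A (Suc l) r = Cons False ` ?A l 0"
      by (auto simp: 0 length_Suc_conv split: if_splits)
    then show ?thesis
      using Suc[of 0] 0 by (simp add: card_image)
  next
    case (Suc r')
    have "?A (Suc l) r = Cons True ` ?A l r' \<union> Cons False ` ?A l r"
      by (auto simp: Suc length_Suc_conv split: if_splits)
    moreover have "Cons True ` ?A l r' \<inter> Cons False ` ?A l r = {}"
      by auto
    ultimately show ?thesis
      using Suc.IH[of r'] Suc.IH[of r] Suc by (simp add: card_Un_disjoint card_image)
  qed
qed

lemma probe_language_time_lower_bound:
  assumes dec: "decides_in_time M (probe_language K) T" and "m > 1"
  shows "(m - 1) choose K \<le> T (2 ^ m)"
proof -
  \<comment> \<open>At length \<open>2 ^ m\<close> the address-tape has exactly \<open>m\<close>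
    cells, and every \<open>m\<close>-bit address denotes an actual input cell rather than the
    endmark.\<close>
  define x where "x = replicate (2 ^ m) False"
  \<comment> \<open>Among the visited tapes, those of weight exactly \<open>K\<close> are enough and
    are counted by a single binomial coefficient.\<close>
  define V where "V = {v. length v = m - 1 \<and> count_list v True = K}"
  have V: "V \<subseteq> sparse (m - 1) K"
    by (auto simp: V_def sparse_def)
  have len [simp]: "length x = 2 ^ m"
    by (simp add: x_def)
  have "read_input x a \<noteq> Bit True" for a
    by (auto simp: read_input_def x_def)
  then have "x \<in> probe_language K"
    using search_halts[of m K]
    by (simp add: probe_language_def run_def probe_funpow_reads_no_True init_config_probe del: funpow.simps)
  moreover have "x[p := True] \<notin> probe_language K" if "p \<in> (\<lambda>v. addr_value (True # v)) ` V" for p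
  proof -
    from that obtain v where v: "p = addr_value (True # v)" "v \<in> sparse (m - 1) K" "length v + 1 = m"
      using V \<open>m > 1\<close> by (auto simp: V_def)
    then have "p < 2 ^ m"
      using addr_value_less[of "True # v"] by simp
    then have p: "read_input (x[p := True]) p = Bit True"
      by (simp add: read_input_def)
    have "cstate (run (probe K) (x[p := True]) (4 * m ^ K + 4)) = 1"
      using search_visits[OF \<open>m > 1\<close> v(2)] probe_funpow_reads_True[of K _ _ "4 * m ^ K + 4" "x[p := True]"] p v
      by (auto simp: run_def init_config_probe simp del: funpow.simps)
    then show ?thesis
      by (simp add: probe_language_def)
  qed
  ultimately have "card ((\<lambda>v. addr_value (True # v)) ` V) \<le> T (2 ^ m)"
    using sensitive_le_time[OF dec] by (metis len)
  moreover have "inj_on (\<lambda>v. addr_value (True # v)) V"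
    by (auto simp: inj_on_def V_def dest!: addr_value_inject[rotated])
  ultimately show ?thesis
    using card_weight_lists[of "m - 1" K] by (simp add: card_image V_def)
qed

section \<open>The hierarchy\<close>

lemma DTIME_mono:
  assumes "f \<in> O(g)"
  shows "DTIME f \<subseteq> DTIME g"
  unfolding DTIME_def using landau_o.big.trans[OF _ assms] by blast

lemma log_power_bigo: "(\<lambda>n. (log 2 (real n)) ^ k) \<in> O(\<lambda>n. (log 2 (real n)) ^ (k + 1))"
proof (rule landau_o.big_mono)
  show "\<forall>\<^sub>F n in sequentially. norm ((log 2 (real n)) ^ k) \<le> norm ((log 2 (real n)) ^ (k + 1))"
    using eventually_ge_at_top[of 2]
  proof eventually_elim
    case (elim n)
    then have "1 \<le> norm (log 2 (real n))" by simp
    then show ?case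
      unfolding norm_power by (intro power_increasing) simp_all
  qed
qed

lemma probe_language_in_DTIME: "probe_language K \<in> DTIME (\<lambda>n. (log 2 (real n)) ^ K)"
proof -
  have "(\<lambda>n. real (4 * addr_length n ^ K + 4)) \<in> O(\<lambda>n. (log 2 (real n)) ^ K)"
  proof (rule bigoI)
    show "\<forall>\<^sub>F n in sequentially.
        norm (real (4 * addr_length n ^ K + 4)) \<le> (4 * 2 ^ K + 4) * norm ((log 2 (real n)) ^ K)"
      using eventually_ge_at_top[of 2]
    proof eventually_elim
      case (elim n)
      then have log: "1 \<le> log 2 (real n)" by simp
      define y where "y = (log 2 (real n)) ^ K"
      \<comment> \<open>Rounding up adds less than 1, which is at most the logarithm itself.\<close>
      have "real (addr_length n) \<le> 2 * log 2 (real n)"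
        using log unfolding addr_length_def by linarith
      then have "real (addr_length n) ^ K \<le> (2 * log 2 (real n)) ^ K"
        by (intro power_mono) auto
      then have "real (addr_length n) ^ K \<le> 2 ^ K * y"
        by (simp add: power_mult_distrib y_def)
      moreover have "1 \<le> y"
        using log by (simp add: y_def)
      ultimately have "4 * real (addr_length n) ^ K + 4 \<le> (4 * 2 ^ K + 4) * y"
        by (simp add: distrib_right)
      with \<open>1 \<le> y\<close> show ?case
        unfolding y_def[symmetric] by simp
    qed
  qed
  then show ?thesis
    unfolding DTIME_def using wf_probe probe_decides
    by (intro CollectI exI conjI)
qed

lemma probe_language_notin_DTIME: "probe_language (k + 1) \<notin> DTIME (\<lambda>n. (log 2 (real n)) ^ k)"
proof
  assume "probe_language (k + 1) \<in> DTIME (\<lambda>n. (log 2 (real n)) ^ k)"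
  then obtain M T where dec: "decides_in_time M (probe_language (k + 1)) T"
    and T: "(\<lambda>n. real (T n)) \<in> O(\<lambda>n. (log 2 (real n)) ^ k)"
    by (auto simp: DTIME_def)
  from landau_o.bigE[OF T] obtain c where c: "c > 0"
    "\<forall>\<^sub>F n in sequentially. norm (real (T n)) \<le> c * norm ((log 2 (real n)) ^ k)"
    by blast
  then obtain N where N: "\<And>n. n \<ge> N \<Longrightarrow> real (T n) \<le> c * \<bar>log 2 (real n)\<bar> ^ k"
    unfolding eventually_sequentially by (auto simp: power_abs)
  \<comment> \<open>Comparing \<open>((m - 1) / (k + 1)) ^ (k + 1)\<close> with the upper bound and
    cancelling \<open>(m - 1) ^ k\<close> will leave \<open>m - 1 \<le> d\<close>.\<close>
  define d where "d = 2 ^ k * c * real (k + 1) ^ (k + 1)"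
  have q_pos: "0 < real (k + 1) ^ (k + 1)"
    by simp
  \<comment> \<open>\<open>N\<close> makes the upper bound applicable at \<open>2 ^ m\<close>,
    \<open>k + 2\<close> gives \<open>k + 1 \<le> m - 1\<close> for the binomial estimate and
    \<open>m \<le> 2 * (m - 1)\<close>, and the last summand forces
    \<open>m - 1 > d\<close>.\<close>
  define m where "m = N + k + 2 + nat \<lceil>d\<rceil>"
  have "N \<le> 2 ^ m"
    using less_exp[of m] by (simp add: m_def)
  then have "real (T (2 ^ m)) \<le> c * real m ^ k"
    using N[of "2 ^ m"] by (simp add: log_nat_power)
  also have "\<dots> \<le> c * (2 * real (m - 1)) ^ k"
    using c by (intro mult_left_mono power_mono) (auto simp: m_def)
  finally have upper: "real (T (2 ^ m)) \<le> 2 ^ k * c * real (m - 1) ^ k"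
    by (simp add: power_mult_distrib mult_ac)
  have "(real (m - 1) / real (k + 1)) ^ (k + 1) \<le> real ((m - 1) choose (k + 1))"
    using binomial_ge_n_over_k_pow_k[of "k + 1" "m - 1", where 'a = real] by (simp add: m_def)
  also have "\<dots> \<le> real (T (2 ^ m))"
    using probe_language_time_lower_bound[OF dec, of m] by (simp add: m_def)
  finally have "(real (m - 1) / real (k + 1)) ^ (k + 1) \<le> 2 ^ k * c * real (m - 1) ^ k"
    using upper by linarith
  then have "real (m - 1) ^ (k + 1) \<le> 2 ^ k * c * real (m - 1) ^ k * real (k + 1) ^ (k + 1)"
    unfolding power_divide pos_divide_le_eq[OF q_pos] .
  then have "real (m - 1) ^ k * real (m - 1) \<le> real (m - 1) ^ k * d"
    by (simp only: d_def power_add power_one_right mult_ac)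
  moreover have "real (m - 1) ^ k > 0"
    by (simp add: m_def)
  ultimately have "real (m - 1) \<le> d"
    by simp
  moreover have "d \<le> real (nat \<lceil>d\<rceil>)"
    by linarith
  ultimately show False
    by (simp add: m_def)
qed

theorem theorem1:
  fixes k :: nat
  assumes "k > 1"
  shows "DTIME (\<lambda>n. (log 2 (real n)) ^ k) \<subset> DTIME (\<lambda>n. (log 2 (real n)) ^ (k + 1))"
  using DTIME_mono[OF log_power_bigo] probe_language_in_DTIME[of "k + 1"] probe_language_notin_DTIME
  by blast

end
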